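(* Let $\mathcal V$ be a non-principal ultrafilter on $\mathbb N$ and let $\xi,\eta\in\mu^-(1)$. Then ${}^{\ast}T_G(\xi,\eta)={}^{\ast}T_{NM}(\xi,\eta)=\min\{\xi,\eta\}$, ${}^{\ast}T_L(\xi,\eta)=\xi+\eta-1$, ${}^{\ast}T_P(\xi,\eta)=\xi\eta$, and ${}^{\ast}T_D(\xi,\eta)=0$.
   Context: ${}^{\ast}\mathbb R=\mathbb R^{\mathbb N}/\mathcal V$ is the ultrapower of the ordered field of real numbers, and ${}^{\ast}[0,1]\subseteq{}^{\ast}\mathbb R$ is the induced ultrapower of $[0,1]$. For $T:[0,1]^2\to[0,1]$, the extension ${}^{\ast}T:{}^{\ast}[0,1]^2\to{}^{\ast}[0,1]$ is ${}^{\ast}T([x_n]_{\mathcal V},[y_n]_{\mathcal V})=[T(x_n,y_n)]_{\mathcal V}$. The left monad of $1$ is $\mu^-(1)=\{\xi\in{}^{\ast}[0,1]:0<1-\xi<\tfrac1n\text{ for every integer }n\ge2\}$. The operations $[0,1]^2\to[0,1]$ are: $T_G(x,y)=\min\{x,y\}$; $T_L(x,y)=\max\{0,x+y-1\}$; $T_P(x,y)=xy$; $T_{NM}(x,y)=\min\{x,y\}$ if $x+y>1$ and $0$ if $x+y\le 1$; $T_D(x,y)=\min\{x,y\}$ if $\max\{x,y\}=1$ and $0$ if $\max\{x,y\}<1$. *)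

theory Defs
  imports Complex_Main
begin

text \<open>
  A filter on \<open>'a\<close> in the sense of the library is identified with the family of sets \<open>A\<close> such that
  \<open>eventually (\<lambda>x. x \<in> A)\<close> holds; \<open>principal {a}\<close> consists of the sets containing \<open>a\<close>.
\<close>

definition ultrafilter :: "'a filter \<Rightarrow> bool" where
  "ultrafilter V \<longleftrightarrow> V \<noteq> bot \<and> (\<forall>P. eventually P V \<or> eventually (\<lambda>x. \<not> P x) V)"

definition nonprincipal :: "'a filter \<Rightarrow> bool" where
  "nonprincipal V \<longleftrightarrow> (\<forall>a. V \<noteq> principal {a})"

text \<open>
  Since a type cannot depend on the ultrafilter, the ultrapower is the quotient set of all real
  sequences, and its elements are equivalence classes.
\<close>

definition ueq :: "nat filter \<Rightarrow> ((nat \<Rightarrow> real) \<times> (nat \<Rightarrow> real)) set" where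
  "ueq V = {(x, y). eventually (\<lambda>n. x n = y n) V}"

definition ucls :: "nat filter \<Rightarrow> (nat \<Rightarrow> real) \<Rightarrow> (nat \<Rightarrow> real) set" where
  "ucls V x = ueq V `` {x}"

definition star_real :: "nat filter \<Rightarrow> (nat \<Rightarrow> real) set set" where
  "star_real V = UNIV // ueq V"

text \<open>The ultrapower of \<open>S\<close>, as a subset of the ultrapower of the reals.\<close>

definition star_set :: "nat filter \<Rightarrow> real set \<Rightarrow> (nat \<Rightarrow> real) set set" where
  "star_set V S = {ucls V x | x. \<forall>n. x n \<in> S}"

text \<open>
  The extension of \<open>f : S \<times> S \<rightarrow> \<real>\<close>. Only representatives with all values in \<open>S\<close> are used, so the
  values of \<open>f\<close> outside \<open>S \<times> S\<close> are irrelevant. The union is over equal classes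
  (see \<open>star_op_ucls\<close> below).
\<close>

definition star_op :: "nat filter \<Rightarrow> real set \<Rightarrow> (real \<Rightarrow> real \<Rightarrow> real) \<Rightarrow>
    (nat \<Rightarrow> real) set \<Rightarrow> (nat \<Rightarrow> real) set \<Rightarrow> (nat \<Rightarrow> real) set" where
  "star_op V S f X Y =
    (\<Union>x \<in> {x \<in> X. \<forall>n. x n \<in> S}. \<Union>y \<in> {y \<in> Y. \<forall>n. y n \<in> S}. ucls V (\<lambda>n. f (x n) (y n)))"

definition star_of :: "nat filter \<Rightarrow> real \<Rightarrow> (nat \<Rightarrow> real) set" where
  "star_of V r = ucls V (\<lambda>n. r)"

definition star_add :: "nat filter \<Rightarrow> (nat \<Rightarrow> real) set \<Rightarrow> (nat \<Rightarrow> real) set \<Rightarrow> (nat \<Rightarrow> real) set" where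
  "star_add V = star_op V UNIV (+)"

definition star_diff :: "nat filter \<Rightarrow> (nat \<Rightarrow> real) set \<Rightarrow> (nat \<Rightarrow> real) set \<Rightarrow> (nat \<Rightarrow> real) set" where
  "star_diff V = star_op V UNIV (-)"

definition star_mult :: "nat filter \<Rightarrow> (nat \<Rightarrow> real) set \<Rightarrow> (nat \<Rightarrow> real) set \<Rightarrow> (nat \<Rightarrow> real) set" where
  "star_mult V = star_op V UNIV (*)"

definition star_le :: "nat filter \<Rightarrow> (nat \<Rightarrow> real) set \<Rightarrow> (nat \<Rightarrow> real) set \<Rightarrow> bool" where
  "star_le V X Y \<longleftrightarrow> (\<exists>x\<in>X. \<exists>y\<in>Y. eventually (\<lambda>n. x n \<le> y n) V)"

definition star_less :: "nat filter \<Rightarrow> (nat \<Rightarrow> real) set \<Rightarrow> (nat \<Rightarrow> real) set \<Rightarrow> bool" where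
  "star_less V X Y \<longleftrightarrow> star_le V X Y \<and> X \<noteq> Y"

text \<open>The minimum for the linear order of the ultrapower, not the pointwise lifting of \<open>min\<close>.\<close>

definition star_min :: "nat filter \<Rightarrow> (nat \<Rightarrow> real) set \<Rightarrow> (nat \<Rightarrow> real) set \<Rightarrow> (nat \<Rightarrow> real) set" where
  "star_min V X Y = (if star_le V X Y then X else Y)"

abbreviation star_unit :: "nat filter \<Rightarrow> (nat \<Rightarrow> real) set set" where
  "star_unit V \<equiv> star_set V {0..1}"

abbreviation star_T :: "nat filter \<Rightarrow> (real \<Rightarrow> real \<Rightarrow> real) \<Rightarrow>
    (nat \<Rightarrow> real) set \<Rightarrow> (nat \<Rightarrow> real) set \<Rightarrow> (nat \<Rightarrow> real) set" where
  "star_T V T \<equiv> star_op V {0..1} T"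

definition left_monad_1 :: "nat filter \<Rightarrow> (nat \<Rightarrow> real) set set" where
  "left_monad_1 V = {\<xi> \<in> star_unit V. \<forall>m::nat. 2 \<le> m \<longrightarrow>
     star_less V (star_of V 0) (star_diff V (star_of V 1) \<xi>) \<and>
     star_less V (star_diff V (star_of V 1) \<xi>) (star_of V (1 / real m))}"

text \<open>The operations below are only relevant for arguments in \<open>{0..1}\<close>.\<close>

definition T_G :: "real \<Rightarrow> real \<Rightarrow> real" where
  "T_G x y = min x y"

definition T_L :: "real \<Rightarrow> real \<Rightarrow> real" where
  "T_L x y = max 0 (x + y - 1)"

definition T_P :: "real \<Rightarrow> real \<Rightarrow> real" where
  "T_P x y = x * y"

definition T_NM :: "real \<Rightarrow> real \<Rightarrow> real" where
  "T_NM x y = (if x + y > 1 then min x y else 0)"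

definition T_D :: "real \<Rightarrow> real \<Rightarrow> real" where
  "T_D x y = (if max x y = 1 then min x y else 0)"

lemma equiv_ueq: "equiv UNIV (ueq V)"
  unfolding equiv_def refl_on_def sym_def trans_def ueq_def
  by (auto elim: eventually_mono eventually_elim2)

lemma mem_ucls_iff: "y \<in> ucls V x \<longleftrightarrow> eventually (\<lambda>n. x n = y n) V"
  by (simp add: ucls_def ueq_def)

lemma ucls_eq_iff: "ucls V x = ucls V y \<longleftrightarrow> eventually (\<lambda>n. x n = y n) V"
  unfolding ucls_def using eq_equiv_class_iff[OF equiv_ueq, of x y V]
  by (simp add: ueq_def)

lemma star_set_UNIV: "star_set V UNIV = star_real V"
  by (auto simp: star_set_def star_real_def ucls_def quotient_def)

lemma star_op_ucls:
  assumes "\<And>n. x n \<in> S" "\<And>n. y n \<in> S"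
  shows "star_op V S f (ucls V x) (ucls V y) = ucls V (\<lambda>n. f (x n) (y n))"
proof -
  have *: "ucls V (\<lambda>n. f (x' n) (y' n)) = ucls V (\<lambda>n. f (x n) (y n))"
    if "x' \<in> ucls V x" "y' \<in> ucls V y" for x' y'
    using that unfolding mem_ucls_iff ucls_eq_iff by eventually_elim simp
  have "x \<in> ucls V x" "y \<in> ucls V y"
    by (simp_all add: mem_ucls_iff)
  with assms * show ?thesis
    unfolding star_op_def by blast
qed

lemma star_le_ucls: "star_le V (ucls V x) (ucls V y) \<longleftrightarrow> eventually (\<lambda>n. x n \<le> y n) V"
proof
  assume "star_le V (ucls V x) (ucls V y)"
  then obtain x' y' where "eventually (\<lambda>n. x n = x' n) V" "eventually (\<lambda>n. y n = y' n) V"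
      "eventually (\<lambda>n. x' n \<le> y' n) V"
    by (auto simp: star_le_def mem_ucls_iff)
  then show "eventually (\<lambda>n. x n \<le> y n) V"
    by eventually_elim simp
next
  assume "eventually (\<lambda>n. x n \<le> y n) V"
  then show "star_le V (ucls V x) (ucls V y)"
    unfolding star_le_def by (intro bexI[of _ x] bexI[of _ y]) (simp_all add: mem_ucls_iff)
qed

lemma star_less_ucls:
  assumes "ultrafilter V"
  shows "star_less V (ucls V x) (ucls V y) \<longleftrightarrow> eventually (\<lambda>n. x n < y n) V"
proof
  assume "star_less V (ucls V x) (ucls V y)"
  then have le: "eventually (\<lambda>n. x n \<le> y n) V" and "\<not> eventually (\<lambda>n. x n = y n) V"
    by (auto simp: star_less_def star_le_ucls ucls_eq_iff)
  then have "eventually (\<lambda>n. x n \<noteq> y n) V"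
    using assms by (auto simp: ultrafilter_def)
  with le show "eventually (\<lambda>n. x n < y n) V"
    by eventually_elim simp
next
  assume less: "eventually (\<lambda>n. x n < y n) V"
  have "\<not> eventually (\<lambda>n. x n = y n) V"
  proof
    assume "eventually (\<lambda>n. x n = y n) V"
    with less have "eventually (\<lambda>n. False) V"
      by eventually_elim simp
    then show False
      using assms by (simp add: ultrafilter_def eventually_False)
  qed
  with less show "star_less V (ucls V x) (ucls V y)"
    by (auto simp: star_less_def star_le_ucls ucls_eq_iff elim: eventually_mono)
qed

end

theory Submission
  imports Defs
begin

text \<open>
  Represent \<open>\<xi>\<close> and \<open>\<eta>\<close> by sequences \<open>x\<close> and \<open>y\<close> in the unit interval. Lying in the left monad of
  \<open>1\<close>, they satisfy \<open>1/2 < x n < 1\<close> and \<open>1/2 < y n < 1\<close> for almost all \<open>n\<close>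
  (\<open>left_monad_1_representative\<close>). So almost everywhere \<open>x n + y n > 1\<close>, which selects the
  nonzero branch of \<open>T_NM\<close> and of \<open>T_L\<close>, and \<open>max (x n) (y n) < 1\<close>, which selects the zero branch
  of \<open>T_D\<close>. Hence each operation agrees almost everywhere with a single formula in \<open>x n\<close> and
  \<open>y n\<close>, and sequences that agree almost everywhere have the same class.
\<close>

text \<open>
  By the ultrafilter property, one of \<open>x n \<le> y n\<close> and \<open>y n < x n\<close> holds almost everywhere, so
  the pointwise minimum almost everywhere picks the same argument, namely the
  smaller one for the order of the ultrapower.
\<close>

lemma star_min_ucls:
  assumes "ultrafilter V"
  shows "star_min V (ucls V x) (ucls V y) = ucls V (\<lambda>n. min (x n) (y n))"
proof (cases "eventually (\<lambda>n. x n \<le> y n) V")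
  case True
  then have "eventually (\<lambda>n. x n = min (x n) (y n)) V"
    by eventually_elim simp
  then show ?thesis
    using True by (simp add: star_min_def star_le_ucls ucls_eq_iff)
next
  case False
  then have "eventually (\<lambda>n. \<not> x n \<le> y n) V"
    using assms by (auto simp: ultrafilter_def)
  then have "eventually (\<lambda>n. y n = min (x n) (y n)) V"
    by eventually_elim simp
  then show ?thesis
    using False by (simp add: star_min_def star_le_ucls ucls_eq_iff)
qed

text \<open>
  The upper bound \<open>1/2\<close> on \<open>1 - \<xi>\<close>, that is, the case \<open>m = 2\<close> of the definition, is what makes
  the sum of two elements of the monad exceed \<open>1\<close>.
\<close>

lemma left_monad_1_representative:
  assumes "ultrafilter V" and "\<xi> \<in> left_monad_1 V"
  obtains x where "\<xi> = ucls V x" and "\<And>n. x n \<in> {0..1}"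
    and "eventually (\<lambda>n. 1 / 2 < x n \<and> x n < 1) V"
proof -
  from assms(2) obtain x where x: "\<xi> = ucls V x" "\<And>n. x n \<in> {0..1}"
    unfolding left_monad_1_def star_set_def by blast
  have diff: "star_diff V (star_of V 1) \<xi> = ucls V (\<lambda>n. 1 - x n)"
    by (simp add: x(1) star_diff_def star_of_def star_op_ucls)
  have "star_less V (star_of V 0) (ucls V (\<lambda>n. 1 - x n))"
    and "star_less V (ucls V (\<lambda>n. 1 - x n)) (star_of V (1 / real 2))"
    using assms(2) unfolding left_monad_1_def diff[symmetric] by blast+
  then have "eventually (\<lambda>n. 0 < 1 - x n) V" and "eventually (\<lambda>n. 1 - x n < 1 / 2) V"
    by (simp_all add: star_of_def star_less_ucls[OF assms(1)])
  then have "eventually (\<lambda>n. 1 / 2 < x n \<and> x n < 1) V"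
    by eventually_elim simp
  with x show thesis
    by (rule that)
qed

theorem proposition7p3:
  fixes V :: "nat filter" and \<xi> \<eta> :: "(nat \<Rightarrow> real) set"
  assumes "ultrafilter V" and "nonprincipal V"
    and "\<xi> \<in> left_monad_1 V" and "\<eta> \<in> left_monad_1 V"
  shows "star_T V T_G \<xi> \<eta> = star_min V \<xi> \<eta> \<and>
    star_T V T_NM \<xi> \<eta> = star_min V \<xi> \<eta> \<and>
    star_T V T_L \<xi> \<eta> = star_diff V (star_add V \<xi> \<eta>) (star_of V 1) \<and>
    star_T V T_P \<xi> \<eta> = star_mult V \<xi> \<eta> \<and>
    star_T V T_D \<xi> \<eta> = star_of V 0"
proof -
  obtain x where x: "\<xi> = ucls V x" "\<And>n. x n \<in> {0..1}"
      "eventually (\<lambda>n. 1 / 2 < x n \<and> x n < 1) V"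
    using left_monad_1_representative[OF assms(1,3)] by blast
  obtain y where y: "\<eta> = ucls V y" "\<And>n. y n \<in> {0..1}"
      "eventually (\<lambda>n. 1 / 2 < y n \<and> y n < 1) V"
    using left_monad_1_representative[OF assms(1,4)] by blast
  have T: "star_T V f \<xi> \<eta> = ucls V (\<lambda>n. f (x n) (y n))" for f
    unfolding x(1) y(1) by (rule star_op_ucls[OF x(2) y(2)])
  have min: "star_min V \<xi> \<eta> = ucls V (\<lambda>n. min (x n) (y n))"
    unfolding x(1) y(1) by (rule star_min_ucls[OF assms(1)])
  have add: "star_diff V (star_add V \<xi> \<eta>) (star_of V 1) = ucls V (\<lambda>n. x n + y n - 1)"
    by (simp add: x(1) y(1) star_diff_def star_add_def star_of_def star_op_ucls)
  have mult: "star_mult V \<xi> \<eta> = ucls V (\<lambda>n. x n * y n)"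
    by (simp add: x(1) y(1) star_mult_def star_op_ucls)
  have NM: "eventually (\<lambda>n. T_NM (x n) (y n) = min (x n) (y n)) V"
    using x(3) y(3) by eventually_elim (auto simp: T_NM_def)
  have L: "eventually (\<lambda>n. T_L (x n) (y n) = x n + y n - 1) V"
    using x(3) y(3) by eventually_elim (auto simp: T_L_def)
  have D: "eventually (\<lambda>n. T_D (x n) (y n) = 0) V"
    using x(3) y(3) by eventually_elim (auto simp: T_D_def max_def)
  show ?thesis
    unfolding T min add mult unfolding star_of_def ucls_eq_iff
    using NM L D by (simp add: T_G_def T_P_def)
qed

end
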